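(* Let $n\ge 2$ and let $f:\mathbb{R}_+\to\mathbb{R}$ be smooth on $(0,\infty)$ and satisfy $f(x)=O(x^2)$ as $x\to 0$, $f'(x)=O(x)$ as $x\to 0$, $f(x)=O(x^2)$ as $x\to\infty$, and, on $(0,\infty)$, $f''>0$ and $\frac{d^2}{dx^2}\left(\frac{f}{f'}\right)>0$. Let $M=(0,\infty)^n$ be equipped with the metric $$ds^2=\frac{dx_1^2}{f(x_1)}+\cdots+\frac{dx_n^2}{f(x_n)}-\frac{(dx_1+\cdots+dx_n)^2}{f(x_1+\cdots+x_n)},$$ and let $L^{n+1}$ be $\mathbb{R}^{n+1}$ with the flat Minkowski metric $ds_L^2=dy_1^2+\cdots+dy_n^2-dy_{n+1}^2$. Define $\eta:(0,\infty)\to\mathbb{R}$ by $\eta(x)=\int_1^x\frac{dr}{\sqrt{f(r)}}$. Then the mapping $$\Phi:M\to L^{n+1},\qquad (x_1,\ldots,x_n)\mapsto(\eta(x_1),\ldots,\eta(x_n),\eta(x_1+\cdots+x_n))$$ is an isometric embedding.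
   Context: The assumptions on $f$ imply $f>0$ and $f'>0$ on $(0,\infty)$. "Isometric embedding" means a smooth embedding with $\Phi^*(ds_L^2)=ds^2$. *)

theory Defs
  imports "HOL-Analysis.Analysis" "HOL-Library.Landau_Symbols"
begin

(* C^k for functions on an open set S: f is C^(k+1) iff it is differentiable on S and all its
   directional derivatives are C^k on S. *)
primrec C_k_on :: "nat \<Rightarrow> 'a set \<Rightarrow> ('a::real_normed_vector \<Rightarrow> 'b::real_normed_vector) \<Rightarrow> bool"
  where
    "C_k_on 0 S f \<longleftrightarrow> continuous_on S f"
  | "C_k_on (Suc k) S f \<longleftrightarrow>
       (\<forall>x\<in>S. f differentiable (at x)) \<and>
       (\<forall>v. C_k_on k S (\<lambda>x. frechet_derivative f (at x) v))"

definition smooth_on :: "'a set \<Rightarrow> ('a::real_normed_vector \<Rightarrow> 'b::real_normed_vector) \<Rightarrow> bool"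
  where "smooth_on S f \<longleftrightarrow> (\<forall>k. C_k_on k S f)"

definition smooth_embedding_on ::
    "'a set \<Rightarrow> ('a::euclidean_space \<Rightarrow> 'b::euclidean_space) \<Rightarrow> bool"
  where "smooth_embedding_on S \<Phi> \<longleftrightarrow>
    smooth_on S \<Phi> \<and>
    (\<forall>x\<in>S. inj (frechet_derivative \<Phi> (at x))) \<and>
    embedding_map (top_of_set S) euclidean \<Phi>"

(* A field of bilinear forms: "g p u v" is the value at the point p on the tangent vectors u, v. *)
type_synonym 'a form_field = "'a \<Rightarrow> 'a \<Rightarrow> 'a \<Rightarrow> real"

definition pullback ::
    "('a::euclidean_space \<Rightarrow> 'b::euclidean_space) \<Rightarrow> 'b form_field \<Rightarrow> 'a form_field"
  where "pullback \<Phi> h p u v =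
    h (\<Phi> p) (frechet_derivative \<Phi> (at p) u) (frechet_derivative \<Phi> (at p) v)"

definition isometric_embedding_on ::
    "'a set \<Rightarrow> 'a form_field \<Rightarrow> 'b form_field \<Rightarrow> ('a::euclidean_space \<Rightarrow> 'b::euclidean_space) \<Rightarrow> bool"
  where "isometric_embedding_on S g h \<Phi> \<longleftrightarrow>
    smooth_embedding_on S \<Phi> \<and> (\<forall>p\<in>S. \<forall>u v. pullback \<Phi> h p u v = g p u v)"

definition pos_orthant :: "(real ^ 'n) set"
  where "pos_orthant = {x. \<forall>i. 0 < x $ i}"

(* ds^2 as a symmetric bilinear form: "dx_i" picks the i-th component of a tangent vector. *)
definition ds2 :: "(real \<Rightarrow> real) \<Rightarrow> (real ^ 'n) form_field"
  where "ds2 f x u v =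
    (\<Sum>i\<in>UNIV. (u $ i) * (v $ i) / f (x $ i)) -
    (\<Sum>i\<in>UNIV. u $ i) * (\<Sum>i\<in>UNIV. v $ i) / f (\<Sum>i\<in>UNIV. x $ i)"

(* Minkowski space of dimension n + 1 is (real ^ 'n) \<times> real, the last factor being y_{n+1}. *)
definition minkowski :: "((real ^ 'n) \<times> real) form_field"
  where "minkowski y u v = (\<Sum>i\<in>UNIV. (fst u $ i) * (fst v $ i)) - snd u * snd v"

(* The interval integral is oriented: for x < 1 it is minus the integral from x to 1. *)
definition eta :: "(real \<Rightarrow> real) \<Rightarrow> real \<Rightarrow> real"
  where "eta f x = (LBINT r=ereal 1..ereal x. 1 / sqrt (f r))"

definition Phi_map :: "(real \<Rightarrow> real) \<Rightarrow> real ^ 'n \<Rightarrow> (real ^ 'n) \<times> real"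
  where "Phi_map f x = ((\<chi> i. eta f (x $ i)), eta f (\<Sum>i\<in>UNIV. x $ i))"

end

theory Submission
  imports Defs
begin

text \<open>Each coordinate of the map is \<open>\<eta>\<close> applied to a positive linear form of the point, and
  \<open>\<eta>' = 1 / sqrt f\<close>. The differential therefore sends a tangent vector \<open>v\<close> to the vector with
  components \<open>v\<^sub>i / sqrt (f x\<^sub>i)\<close> and \<open>(\<Sum>v\<^sub>i) / sqrt (f (\<Sum>x\<^sub>i))\<close>
  (\<open>has_derivative_Phi_map\<close>). Multiplying such components in the Minkowski form turns the square
  roots into the denominators \<open>f x\<^sub>i\<close> and \<open>f (\<Sum>x\<^sub>i)\<close> of the given metric, which is the isometry;
  the first \<open>n\<close> components alone show that the differential is injective.

  This makes sense because \<open>f\<close> is positive (\<open>profile_pos\<close>): convexity makes \<open>f'\<close> increasing, the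
  growth bound at \<open>0\<close> makes it tend to \<open>0\<close> there, so \<open>f' > 0\<close>, and the same reasoning
  one order lower gives \<open>f > 0\<close>.

  Smoothness (\<open>smooth_Phi_map\<close>) reduces to the chain rule for the scalar functions \<open>t powr a\<close>, \<open>f\<close>
  and \<open>\<eta>\<close>. The map is a homeomorphism onto its image (\<open>embedding_map_Phi_map\<close>) because \<open>\<eta>\<close> is
  strictly increasing and continuous on an interval, hence has a continuous inverse, and applying
  this inverse to the first \<open>n\<close> coordinates of the image recovers the point.\<close>

section \<open>Calculus of k times continuously differentiable maps\<close>

lemma C_k_on_cong:
  assumes "open S" "\<And>x. x \<in> S \<Longrightarrow> f x = g x" "C_k_on k S f"
  shows "C_k_on k S g"
  using assms(2,3)
proof (induction k arbitrary: f g)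
  case 0
  then show ?case using continuous_on_cong by force
next
  case (Suc k)
  have diff: "f differentiable (at x)" if "x \<in> S" for x
    using Suc.prems(2) that by simp
  have eq: "frechet_derivative f (at x) = frechet_derivative g (at x)" if "x \<in> S" for x
    by (rule frechet_derivative_transform_within_open[OF diff[OF that] \<open>open S\<close> that])
      (rule Suc.prems(1))
  have "g differentiable (at x)" if "x \<in> S" for x
    using diff[OF that] that Suc.prems(1) \<open>open S\<close>
    unfolding differentiable_def by (meson has_derivative_transform_within_open)
  moreover have "C_k_on k S (\<lambda>x. frechet_derivative g (at x) v)" for v
    by (rule Suc.IH[of "\<lambda>x. frechet_derivative f (at x) v"]) (use Suc.prems(2) eq in auto)
  ultimately show ?case by simp
qed

text \<open>The recursion in the definition of \<^const>\<open>C_k_on\<close> speaks of the chosen derivative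
  \<^const>\<open>frechet_derivative\<close>; this rule accepts any formula for the derivative instead, so that the
  closure properties follow from the usual differentiation rules by induction on the order.\<close>

lemma C_k_on_SucI:
  assumes "open S" "\<And>x. x \<in> S \<Longrightarrow> (f has_derivative D x) (at x)"
    and "\<And>v. C_k_on k S (\<lambda>x. D x v)"
  shows "C_k_on (Suc k) S f"
proof -
  have "C_k_on k S (\<lambda>x. frechet_derivative f (at x) v)" for v
    by (rule C_k_on_cong[OF assms(1) _ assms(3)[of v]])
      (metis assms(2) frechet_derivative_at)
  with assms(2) show ?thesis by (auto simp: differentiable_def)
qed

lemma C_k_on_imp_continuous_on: "C_k_on k S f \<Longrightarrow> continuous_on S f"
  by (cases k)
    (auto intro!: continuous_at_imp_continuous_on intro: differentiable_imp_continuous_within)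

lemma C_k_on_SucD: "C_k_on (Suc k) S f \<Longrightarrow> C_k_on k S f"
proof (induction k arbitrary: f)
  case 0
  then show ?case using C_k_on_imp_continuous_on C_k_on.simps(1) by blast
next
  case (Suc k)
  have "C_k_on (Suc k) S (\<lambda>x. frechet_derivative f (at x) v)" for v
    using Suc.prems C_k_on.simps(2) by blast
  then have "C_k_on k S (\<lambda>x. frechet_derivative f (at x) v)" for v
    by (rule Suc.IH)
  with Suc.prems show ?case by simp
qed

lemma C_k_on_Suc_has_derivative:
  assumes "C_k_on (Suc k) S f" "x \<in> S"
  shows "(f has_derivative frechet_derivative f (at x)) (at x)"
  using assms frechet_derivative_works by auto

lemma C_k_on_const: "open S \<Longrightarrow> C_k_on k S (\<lambda>x. c)"
proof (induction k arbitrary: c)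
  case (Suc k)
  show ?case
    by (rule C_k_on_SucI[where D = "\<lambda>_ _. 0"]) (use Suc in auto)
qed simp

lemma C_k_on_bounded_linear:
  assumes "bounded_linear L" "open S" "C_k_on k S f"
  shows "C_k_on k S (\<lambda>x. L (f x))"
  using assms(3)
proof (induction k arbitrary: f)
  case 0
  then show ?case using bounded_linear.continuous_on[OF assms(1)] by simp
next
  case (Suc k)
  show ?case
  proof (rule C_k_on_SucI[OF assms(2)])
    show "((\<lambda>x. L (f x)) has_derivative (\<lambda>v. L (frechet_derivative f (at x) v))) (at x)"
      if "x \<in> S" for x
      by (intro bounded_linear.has_derivative[OF assms(1)]
          C_k_on_Suc_has_derivative[OF Suc.prems that])
    show "C_k_on k S (\<lambda>x. L (frechet_derivative f (at x) v))" for v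
      using Suc.prems by (intro Suc.IH) simp
  qed
qed

lemma C_k_on_linear:
  assumes "bounded_linear L" "open S"
  shows "C_k_on k S L"
proof (cases k)
  case 0
  then show ?thesis using assms by (simp add: linear_continuous_on)
next
  case (Suc j)
  show ?thesis unfolding Suc
    by (rule C_k_on_SucI[where D = "\<lambda>_. L"])
      (auto intro: assms C_k_on_const bounded_linear_imp_has_derivative)
qed

lemma C_k_on_add:
  assumes "open S" "C_k_on k S f" "C_k_on k S g"
  shows "C_k_on k S (\<lambda>x. f x + g x)"
  using assms(2,3)
proof (induction k arbitrary: f g)
  case 0
  then show ?case by (simp add: continuous_on_add)
next
  case (Suc k)
  show ?case
  proof (rule C_k_on_SucI[OF assms(1)])
    show "((\<lambda>x. f x + g x) has_derivative
        (\<lambda>v. frechet_derivative f (at x) v + frechet_derivative g (at x) v)) (at x)"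
      if "x \<in> S" for x
      using Suc.prems that by (intro has_derivative_add C_k_on_Suc_has_derivative)
    show "C_k_on k S (\<lambda>x. frechet_derivative f (at x) v + frechet_derivative g (at x) v)" for v
      using Suc.prems by (intro Suc.IH) simp_all
  qed
qed

lemma C_k_on_sum:
  assumes "open S" "\<And>i. i \<in> I \<Longrightarrow> C_k_on k S (f i)"
  shows "C_k_on k S (\<lambda>x. \<Sum>i\<in>I. f i x)"
  using assms(2)
  by (induction I rule: infinite_finite_induct)
    (auto intro: C_k_on_const C_k_on_add assms(1))

lemma C_k_on_mult:
  fixes f g :: "'a::real_normed_vector \<Rightarrow> 'b::real_normed_algebra"
  assumes "open S" "C_k_on k S f" "C_k_on k S g"
  shows "C_k_on k S (\<lambda>x. f x * g x)"
  using assms(2,3)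
proof (induction k arbitrary: f g)
  case 0
  then show ?case by (simp add: continuous_on_mult)
next
  case (Suc k)
  have "C_k_on k S f" "C_k_on k S g"
    using Suc.prems by (auto intro: C_k_on_SucD simp del: C_k_on.simps)
  moreover have "C_k_on k S (\<lambda>x. frechet_derivative f (at x) v)"
      "C_k_on k S (\<lambda>x. frechet_derivative g (at x) v)" for v
    using Suc.prems by auto
  ultimately have "C_k_on k S (\<lambda>x. f x * frechet_derivative g (at x) v +
      frechet_derivative f (at x) v * g x)" for v
    by (intro C_k_on_add Suc.IH assms(1))
  moreover have "((\<lambda>x. f x * g x) has_derivative (\<lambda>v. f x * frechet_derivative g (at x) v +
      frechet_derivative f (at x) v * g x)) (at x)" if "x \<in> S" for x
    using Suc.prems that
    by (intro has_derivative_mult C_k_on_Suc_has_derivative)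
  ultimately show ?case
    by (intro C_k_on_SucI[where D = "\<lambda>x v. f x * frechet_derivative g (at x) v +
      frechet_derivative f (at x) v * g x"] assms(1))
qed

lemma C_k_on_Suc_DERIV_I:
  fixes g :: "real \<Rightarrow> real"
  assumes "open S" "\<And>x. x \<in> S \<Longrightarrow> (g has_real_derivative g' x) (at x)" "C_k_on k S g'"
  shows "C_k_on (Suc k) S g"
proof (rule C_k_on_SucI[where D = "\<lambda>x v. g' x * v"])
  show "C_k_on k S (\<lambda>x. g' x * v)" for v
    by (intro C_k_on_mult C_k_on_const assms)
qed (use assms in \<open>auto simp: has_field_derivative_def\<close>)

lemma C_k_on_Suc_DERIV:
  fixes g :: "real \<Rightarrow> real"
  assumes "C_k_on (Suc k) S g" "x \<in> S"
  shows "(g has_real_derivative deriv g x) (at x)"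
  using assms DERIV_deriv_iff_real_differentiable by auto

lemma C_k_on_deriv:
  fixes g :: "real \<Rightarrow> real"
  assumes "open S" "C_k_on (Suc k) S g"
  shows "C_k_on k S (deriv g)"
proof (rule C_k_on_cong[OF assms(1)])
  show "C_k_on k S (\<lambda>x. frechet_derivative g (at x) 1)"
    using assms(2) by simp
  show "frechet_derivative g (at x) 1 = deriv g x" if "x \<in> S" for x
    using frechet_derivative_at[OF C_k_on_Suc_DERIV[OF assms(2) that,
        unfolded has_field_derivative_def]]
    by (metis mult.right_neutral)
qed

text \<open>The outer function is scalar, so the derivative of the composition is a product and the
  induction closes with the product rule; the inner function may live on any normed space.\<close>

lemma C_k_on_compose:
  fixes g :: "real \<Rightarrow> real"
  assumes "open S" "open T" "C_k_on k T g" "C_k_on k S f" "f ` S \<subseteq> T"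
  shows "C_k_on k S (\<lambda>x. g (f x))"
  using assms(3-5)
proof (induction k arbitrary: f g)
  case 0
  then show ?case
    by (simp add: continuous_on_compose2)
next
  case (Suc k)
  have "C_k_on k S (\<lambda>x. deriv g (f x))"
    by (rule Suc.IH[OF C_k_on_deriv[OF assms(2) Suc.prems(1)] C_k_on_SucD[OF Suc.prems(2)]
          Suc.prems(3)])
  moreover have "C_k_on k S (\<lambda>x. frechet_derivative f (at x) v)" for v
    using Suc.prems by simp
  ultimately have "C_k_on k S (\<lambda>x. deriv g (f x) * frechet_derivative f (at x) v)" for v
    by (intro C_k_on_mult assms(1))
  moreover have "((\<lambda>x. g (f x)) has_derivative
      (\<lambda>v. deriv g (f x) * frechet_derivative f (at x) v)) (at x)" if "x \<in> S" for x
  proof -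
    have "(g has_derivative (*) (deriv g (f x))) (at (f x))"
      using C_k_on_Suc_DERIV[OF Suc.prems(1), of "f x"] Suc.prems(3) that
      by (auto simp: has_field_derivative_def)
    then show ?thesis
      by (rule has_derivative_compose[OF C_k_on_Suc_has_derivative[OF Suc.prems(2) that]])
  qed
  ultimately show ?case
    by (intro C_k_on_SucI[where
          D = "\<lambda>x v. deriv g (f x) * frechet_derivative f (at x) v"] assms(1))
qed

text \<open>Powers are closed under differentiation up to a constant factor once the exponent is
  left arbitrary in the induction. The exponent \<open>-1/2\<close> gives the integrand of \<open>\<eta>\<close>.\<close>

lemma C_k_on_powr: "C_k_on k {0<..} (\<lambda>t::real. t powr a)"
proof (induction k arbitrary: a)
  case 0
  show ?case by (auto intro!: continuous_intros)
next
  case (Suc k)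
  show ?case
    by (rule C_k_on_Suc_DERIV_I[where g' = "\<lambda>t. a * t powr (a - 1)"])
      (auto intro!: C_k_on_mult C_k_on_const Suc has_real_derivative_powr)
qed

section \<open>Positivity of the profile function\<close>

text \<open>A function that increases from the limit \<open>0\<close> is nonnegative at \<open>x / 2\<close>, hence positive at
  \<open>x\<close>: comparing with the intermediate point makes the inequality strict.\<close>

lemma pos_if_deriv_pos_and_tendsto_0:
  fixes g :: "real \<Rightarrow> real"
  assumes der: "\<And>x. x > 0 \<Longrightarrow> (g has_real_derivative g' x) (at x)"
    and pos: "\<And>x. x > 0 \<Longrightarrow> g' x > 0"
    and lim: "(g \<longlongrightarrow> 0) (at_right 0)"
    and "x > 0"
  shows "g x > 0"
proof -
  have mono: "g s < g t" if "0 < s" "s < t" for s t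
    using that by (intro DERIV_pos_imp_increasing[of s t g])
      (meson der pos less_le_trans)+
  have "eventually (\<lambda>s. g s \<le> g (x/2)) (at_right 0)"
    using eventually_at_right_less[of 0] eventually_at_right_real[of 0 "x/2"] \<open>x > 0\<close>
    by (auto elim!: eventually_mono intro!: less_imp_le[OF mono])
  then have "0 \<le> g (x/2)"
    by (rule tendsto_upperbound[OF lim]) simp
  also have "\<dots> < g x" using \<open>x > 0\<close> by (intro mono) auto
  finally show ?thesis .
qed

lemma tendsto_0_if_bigo:
  fixes g h :: "real \<Rightarrow> real"
  assumes "g \<in> O[F](h)" "(h \<longlongrightarrow> 0) F"
  shows "(g \<longlongrightarrow> 0) F"
proof -
  obtain c where "eventually (\<lambda>x. norm (g x) \<le> c * norm (h x)) F"
    using assms(1) by (auto simp: bigo_def)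
  then show ?thesis
    by (rule Lim_null_comparison) (use assms(2) in \<open>auto intro: tendsto_eq_intros\<close>)
qed

text \<open>The preceding argument is used twice, first for \<open>f'\<close> and then for \<open>f\<close>; the two growth
  bounds at \<open>0\<close> supply the limits.\<close>

lemma profile_pos:
  fixes f :: "real \<Rightarrow> real"
  assumes "C_k_on 2 {0<..} f"
    and "f \<in> O[at_right 0](\<lambda>x. x ^ 2)" "deriv f \<in> O[at_right 0](\<lambda>x. x)"
    and "\<forall>x>0. (deriv ^^ 2) f x > 0"
    and "x > 0"
  shows "f x > 0"
proof -
  have f2: "C_k_on (Suc (Suc 0)) {0<..} f"
    using assms(1) by (simp add: numeral_2_eq_2)
  have f': "deriv f t > 0" if "t > 0" for t
  proof (rule pos_if_deriv_pos_and_tendsto_0[OF _ _ _ that])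
    show "(deriv f has_real_derivative deriv (deriv f) x) (at x)" if "x > 0" for x
      using C_k_on_Suc_DERIV[OF C_k_on_deriv[OF _ f2]] that by simp
    show "(deriv f \<longlongrightarrow> 0) (at_right 0)"
      by (rule tendsto_0_if_bigo[OF assms(3)]) (auto intro!: tendsto_eq_intros)
  qed (use assms(4) in \<open>auto simp: numeral_2_eq_2\<close>)
  show ?thesis
  proof (rule pos_if_deriv_pos_and_tendsto_0[OF _ f' _ \<open>x > 0\<close>])
    show "(f has_real_derivative deriv f x) (at x)" if "x > 0" for x
      using C_k_on_Suc_DERIV[OF f2] that by simp
    show "(f \<longlongrightarrow> 0) (at_right 0)"
      by (rule tendsto_0_if_bigo[OF assms(2)]) (auto intro!: tendsto_eq_intros)
  qed
qed

section \<open>The coordinate change eta\<close>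

lemma has_real_derivative_eta:
  assumes cont: "continuous_on {0<..} f" and pos: "\<And>x. x > 0 \<Longrightarrow> f x > 0" and "x > 0"
  shows "(eta f has_real_derivative 1 / sqrt (f x)) (at x)"
proof -
  \<comment> \<open>A compact interval inside \<open>(0, \<infinity>)\<close> with the base point \<open>1\<close> in it and \<open>x\<close> in its interior,
    so that the fundamental theorem applies on both sides of \<open>1\<close>.\<close>
  define a b where "a = min 1 x / 2" and "b = max 1 x + 1"
  have ab: "0 < a" "a \<le> 1" "1 \<le> b" "a < x" "x < b"
    using \<open>x > 0\<close> by (auto simp: a_def b_def)
  have "continuous_on {a..b} f"
    by (rule continuous_on_subset[OF cont]) (use ab in auto)
  then have "continuous_on {a..b} (\<lambda>r. 1 / sqrt (f r))"
    using pos ab by (intro continuous_intros) (auto simp: less_imp_neq[symmetric])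
  from interval_integral_FTC2[OF ab(2,3) this] ab
  have "((\<lambda>u. LBINT r=ereal 1..ereal u. 1 / sqrt (f r)) has_vector_derivative
      1 / sqrt (f x)) (at x within {a..b})" by auto
  moreover have "eta f = (\<lambda>u. LBINT r=ereal 1..ereal u. 1 / sqrt (f r))"
    by (auto simp: eta_def)
  moreover have "at x within {a..b} = at x"
    using ab by (intro at_within_interior) auto
  ultimately show ?thesis
    by (simp add: has_real_derivative_iff_has_vector_derivative)
qed

lemma smooth_eta:
  assumes "smooth_on {0<..} f" and pos: "\<And>x. x > 0 \<Longrightarrow> f x > 0"
  shows "smooth_on {0<..} (eta f)"
proof -
  have f: "C_k_on k {0<..} f" for k
    using assms(1) by (simp add: smooth_on_def)
  have Suc: "C_k_on (Suc k) {0<..} (eta f)" for k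
  proof (rule C_k_on_Suc_DERIV_I)
    show "(eta f has_real_derivative f x powr (-1/2)) (at x)" if "x \<in> {0<..}" for x
      using has_real_derivative_eta[OF C_k_on_imp_continuous_on[OF f] pos, of x] that
        pos[of x]
      by (simp add: powr_minus_divide powr_half_sqrt)
    show "C_k_on k {0<..} (\<lambda>x. f x powr (-1/2))"
      by (rule C_k_on_compose[OF _ _ C_k_on_powr f]) (use pos in auto)
  qed simp
  show ?thesis
    unfolding smooth_on_def using C_k_on_SucD[OF Suc] by blast
qed

lemma strict_mono_on_eta:
  assumes "continuous_on {0<..} f" "\<And>x. x > 0 \<Longrightarrow> f x > 0"
  shows "strict_mono_on {0<..} (eta f)"
proof (rule strict_mono_onI)
  fix s t :: real assume "s \<in> {0<..}" "t \<in> {0<..}" "s < t"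
  moreover have "\<exists>y. (eta f has_real_derivative y) (at x) \<and> y > 0" if "x > 0" for x
    using has_real_derivative_eta[OF assms that] assms(2)[OF that] by fastforce
  ultimately show "eta f s < eta f t"
    by (intro DERIV_pos_imp_increasing[of s t "eta f"]) auto
qed

section \<open>The embedding\<close>

lemma open_pos_orthant: "open (pos_orthant :: (real ^ 'n::finite) set)"
proof -
  have "pos_orthant = (\<Inter>i\<in>UNIV. {x::real ^ 'n. 0 < x $ i})"
    by (auto simp: pos_orthant_def)
  also have "open \<dots>"
    by (intro open_INT finite ballI open_Collect_less continuous_intros)
  finally show ?thesis .
qed

lemma sum_pos_orthant: "x \<in> pos_orthant \<Longrightarrow> (\<Sum>i\<in>UNIV. x $ i) > 0"
  by (auto simp: pos_orthant_def intro!: sum_pos)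

lemma smooth_Phi_map:
  assumes "smooth_on {0<..} f" "\<And>x. x > 0 \<Longrightarrow> f x > 0"
  shows "smooth_on (pos_orthant :: (real ^ 'n::finite) set) (Phi_map f)"
proof -
  have eta: "C_k_on k {0<..} (eta f)" for k
    using smooth_eta[OF assms] by (simp add: smooth_on_def)
  have comp: "C_k_on k pos_orthant (\<lambda>x::real ^ 'n. eta f (L x))"
    if "bounded_linear L" "\<And>x. x \<in> pos_orthant \<Longrightarrow> L x > 0" for k L
    by (rule C_k_on_compose[OF open_pos_orthant _ eta C_k_on_linear])
      (use that open_pos_orthant in auto)
  \<comment> \<open>Expanding in the standard basis reduces a vector-valued map to scalar ones.\<close>
  have smooth: "C_k_on k pos_orthant (\<lambda>x::real ^ 'n.
      (\<Sum>i\<in>UNIV. eta f (x $ i) *\<^sub>R (axis i 1, 0)) + eta f (\<Sum>i\<in>UNIV. x $ i) *\<^sub>R (0, 1))" for k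
    by (intro C_k_on_add C_k_on_sum open_pos_orthant
        C_k_on_bounded_linear[OF bounded_linear_scaleR_left] comp
        bounded_linear_vec_nth bounded_linear_sum)
      (auto simp: sum_pos_orthant, auto simp: pos_orthant_def)
  have expansion: "Phi_map f = (\<lambda>x::real ^ 'n. (\<Sum>i\<in>UNIV. eta f (x $ i) *\<^sub>R (axis i 1, 0)) +
      eta f (\<Sum>i\<in>UNIV. x $ i) *\<^sub>R (0, 1))"
    by (auto simp: fun_eq_iff Phi_map_def prod_eq_iff fst_sum snd_sum vec_eq_iff axis_def if_distrib
        sum.delta cong: if_cong)
  show ?thesis unfolding smooth_on_def expansion using smooth by (rule allI)
qed

lemma has_derivative_Phi_map:
  fixes x :: "real ^ 'n::finite"
  assumes "continuous_on {0<..} f" "\<And>x. x > 0 \<Longrightarrow> f x > 0" "x \<in> pos_orthant"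
  shows "(Phi_map f has_derivative (\<lambda>v. ((\<chi> i. v $ i / sqrt (f (x $ i))),
    (\<Sum>i\<in>UNIV. v $ i) / sqrt (f (\<Sum>i\<in>UNIV. x $ i))))) (at x)"
proof -
  have comp: "((\<lambda>x::real ^ 'n. eta f (L x)) has_derivative (\<lambda>v. L v / sqrt (f (L x)))) (at x)"
    if "bounded_linear L" "L x > 0" for L
    using has_derivative_compose[OF bounded_linear_imp_has_derivative[OF that(1)]
        has_real_derivative_eta[OF assms(1,2) that(2), unfolded has_field_derivative_def]]
    by simp
  have "((\<lambda>x. \<chi> i. eta f (x $ i)) has_derivative (\<lambda>v. \<chi> i. v $ i / sqrt (f (x $ i)))) (at x)"
    by (subst has_derivative_componentwise_within)
      (use assms(3) in \<open>auto simp: Basis_vec_def inner_axis pos_orthant_def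
        intro!: comp bounded_linear_vec_nth\<close>)
  moreover have "((\<lambda>x::real ^ 'n. eta f (\<Sum>i\<in>UNIV. x $ i)) has_derivative
      (\<lambda>v. (\<Sum>i\<in>UNIV. v $ i) / sqrt (f (\<Sum>i\<in>UNIV. x $ i)))) (at x)"
    by (rule comp) (use assms(3) in \<open>auto simp: sum_pos_orthant
        intro!: bounded_linear_sum bounded_linear_vec_nth\<close>)
  ultimately show ?thesis
    unfolding Phi_map_def by (rule has_derivative_Pair)
qed

text \<open>A continuous injection of an interval into the line is a homeomorphism onto its image;
  its inverse \<open>\<theta>\<close>, applied to the first \<open>n\<close> coordinates, is a continuous left inverse of the map.\<close>

lemma embedding_map_Phi_map:
  assumes "continuous_on {0<..} f" "\<And>x. x > 0 \<Longrightarrow> f x > 0"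
  shows "embedding_map (top_of_set (pos_orthant :: (real ^ 'n::finite) set)) euclidean (Phi_map f)"
proof -
  have eta: "continuous_on {0<..} (eta f)"
    using has_real_derivative_eta[OF assms]
    by (intro continuous_at_imp_continuous_on) (auto intro: DERIV_isCont)
  have "inj_on (eta f) {0<..}"
    using strict_mono_on_eta[OF assms] by (rule strict_mono_on_imp_inj_on)
  then obtain \<theta> where \<theta>: "homeomorphism {0<..} (eta f ` {0<..}) (eta f) \<theta>"
    using injective_into_1d_eq_homeomorphism[OF eta] convex_imp_path_connected by auto
  define \<Psi> :: "(real ^ 'n) \<times> real \<Rightarrow> real ^ 'n" where "\<Psi> y = (\<chi> i. \<theta> (fst y $ i))" for y
  let ?S = "pos_orthant :: (real ^ 'n) set"
  have inv: "\<Psi> (Phi_map f x) = x" if "x \<in> ?S" for x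
    using that homeomorphism_apply1[OF \<theta>]
    by (auto simp: \<Psi>_def Phi_map_def pos_orthant_def vec_eq_iff)
  have "continuous_on ?S (Phi_map f)"
    using has_derivative_Phi_map[OF assms]
    by (intro continuous_at_imp_continuous_on) (auto intro: has_derivative_continuous)
  moreover have "continuous_on (Phi_map f ` ?S) \<Psi>"
    unfolding \<Psi>_def
  proof (intro continuous_on_vec_lambda continuous_on_compose2[OF homeomorphism_cont2[OF \<theta>]])
    show "continuous_on (Phi_map f ` ?S) (\<lambda>y. fst y $ i)" for i
      by (intro continuous_intros)
    show "(\<lambda>y. fst y $ i) ` Phi_map f ` ?S \<subseteq> eta f ` {0<..}" for i
      by (auto simp: Phi_map_def pos_orthant_def)
  qed
  ultimately have "homeomorphism ?S (Phi_map f ` ?S) (Phi_map f) \<Psi>"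
    using inv by (auto intro!: homeomorphismI)
  then have "homeomorphic_maps (top_of_set ?S) (top_of_set (Phi_map f ` ?S)) (Phi_map f) \<Psi>"
    by (auto simp: homeomorphic_maps_def homeomorphism_def)
  then show ?thesis
    by (auto simp: embedding_map_def homeomorphic_map_maps)
qed

theorem proposition2:
  fixes f :: "real \<Rightarrow> real"
  assumes "CARD('n::finite) \<ge> 2"
    and "smooth_on {0<..} f"
    and "f \<in> O[at_right 0](\<lambda>x. x ^ 2)"
    and "deriv f \<in> O[at_right 0](\<lambda>x. x)"
    and "f \<in> O[at_top](\<lambda>x. x ^ 2)"
    and "\<forall>x>0. (deriv ^^ 2) f x > 0"
    and "\<forall>x>0. (deriv ^^ 2) (\<lambda>t. f t / deriv f t) x > 0"
  shows "isometric_embedding_on (pos_orthant :: (real ^ 'n) set) (ds2 f) minkowski (Phi_map f)"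
proof -
  have f: "C_k_on k {0<..} f" for k
    using assms(2) by (simp add: smooth_on_def)
  note cont = C_k_on_imp_continuous_on[OF f]
  have pos: "f x > 0" if "x > 0" for x
    using profile_pos[OF f assms(3,4,6) that] .
  let ?D = "\<lambda>x v. ((\<chi> i. v $ i / sqrt (f (x $ i))),
    (\<Sum>i\<in>UNIV. v $ i) / sqrt (f (\<Sum>i\<in>UNIV. x $ i)))"
  have D: "frechet_derivative (Phi_map f) (at x) = ?D x" if "x \<in> pos_orthant" for x :: "real ^ 'n"
    using frechet_derivative_at[OF has_derivative_Phi_map[OF cont pos that]] by simp
  have inj: "inj (?D x)" if "x \<in> pos_orthant" for x :: "real ^ 'n"
    using that pos by (auto intro!: injI simp: vec_eq_iff pos_orthant_def less_imp_neq[symmetric])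
  have "pullback (Phi_map f) minkowski x u v = ds2 f x u v"
    if "x \<in> pos_orthant" for x u v :: "real ^ 'n"
  proof -
    have "f (x $ i) > 0" for i using that pos by (auto simp: pos_orthant_def)
    moreover have "f (\<Sum>i\<in>UNIV. x $ i) > 0" using that pos sum_pos_orthant by auto
    ultimately show ?thesis
      by (simp add: pullback_def D[OF that] minkowski_def ds2_def less_imp_le)
  qed
  then show ?thesis
    using smooth_Phi_map[OF assms(2) pos] embedding_map_Phi_map[OF cont pos] inj
    by (simp add: isometric_embedding_on_def smooth_embedding_on_def D)
qed

end
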